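(* Let $m$ and $n$ be positive integers such that $n\ge m$, unless stated otherwise. Then: (1) $$\sum_{k=2}^{\infty}\frac{\zeta(k)}{k(L_nF_m+F_nL_m)^k}=\ln\Gamma\left(\frac{2F_{n+m}-1}{2F_{n+m}}\right)-\frac{\gamma}{2F_{n+m}};$$ (2) $$\sum_{k=2}^{\infty}\frac{\zeta(k)}{k\left(F_n^2+(-1)^{n+m-1}F_m^2\right)^k}=\ln\Gamma\left(\frac{F_{n-m}F_{n+m}-1}{F_{n-m}F_{n+m}}\right)-\frac{\gamma}{F_{n-m}F_{n+m}},\quad n>m;$$ (3) $$\sum_{k=2}^{\infty}\frac{\zeta(k)}{k\left(L_{n+m}+(-1)^mL_{n-m}\right)^k}=\ln\Gamma\left(\frac{L_mL_n-1}{L_mL_n}\right)-\frac{\gamma}{L_mL_n};$$ (4) $$\sum_{k=2}^{\infty}\frac{\zeta(k)}{k(5F_mF_n)^k}=\ln\Gamma\left(\frac{L_{n+m}+(-1)^{m-1}L_{n-m}-1}{L_{n+m}+(-1)^{m-1}L_{n-m}}\right)-\frac{\gamma}{L_{n+m}+(-1)^{m-1}L_{n-m}};$$ (5) $$\sum_{k=2}^{\infty}\frac{\zeta(k)}{k(F_mL_n)^k}=\ln\Gamma\left(\frac{F_{n+m}+(-1)^{m-1}F_{n-m}-1}{F_{n+m}+(-1)^{m-1}F_{n-m}}\right)-\frac{\gamma}{F_{n+m}+(-1)^{m-1}F_{n-m}}.$$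
   Context: $\zeta$ denotes the Riemann zeta function, $\Gamma$ the gamma function, and $\gamma$ the Euler-Mascheroni constant. $F_n$ and $L_n$ denote the Fibonacci and Lucas numbers: both satisfy $x_n=x_{n-1}+x_{n-2}$ for $n\ge 2$, with $F_0=0$, $F_1=1$ and $L_0=2$, $L_1=1$.
   Formalization: In (3) and (5) the case m = n = 1 is excluded: there the base of the powers equals 1, so the series of ζ(k)/k diverges and the right-hand side contains ln Γ(0), which is undefined. *)

theory Defs
  imports "HOL-Analysis.Analysis" "HOL-Number_Theory.Fib"
begin

fun lucas :: "nat \<Rightarrow> nat" where
  "lucas 0 = 2"
| "lucas (Suc 0) = 1"
| "lucas (Suc (Suc n)) = lucas (Suc n) + lucas n"

(* The Riemann zeta function on the real half-line s > 1, where its Dirichlet series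
   converges. It is only ever applied to integers k >= 2; for s <= 1 the value below is
   unspecified and is not the analytic continuation. *)
definition zeta :: "real \<Rightarrow> real" where
  "zeta s = (\<Sum>j. 1 / real (Suc j) powr s)"

end

theory Submission imports Defs begin

text \<open>
  For \<open>0 < x < 1\<close> the power series with coefficients \<open>zeta k / k\<close> has a closed form:
  \<open>(\<Sum>k\<ge>2. zeta k / k * x ^ k) = ln (Gamma (1 - x)) - \<gamma> x\<close> (\<open>zeta_power_series\<close>). It comes
  from the logarithm of Weierstrass' product,
  \<open>ln (Gamma (1 - x)) - \<gamma> x = (\<Sum>j\<ge>1. - ln (1 - x / j) - x / j)\<close>, by expanding each
  summand in powers of \<open>x / j\<close> and exchanging the two summations, all terms being nonnegative.

  The theorem consists of five instances with \<open>x = 1 / N\<close> for an integer \<open>N \<ge> 2\<close>. In each of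
  them the number \<open>N\<close> is written in two ways, once in the series and once in its value; the
  two expressions agree by a product identity for Fibonacci and Lucas numbers, which follows
  from the Binet formulas.
\<close>

section \<open>The zeta series of the logarithm of the gamma function\<close>

text \<open>
  Tonelli's theorem for two sequential summations: nonnegativity lets both iterated sums be
  read off from one unordered sum over all pairs of indices.
\<close>

lemma sums_swap_nonneg:
  fixes f :: "nat \<Rightarrow> nat \<Rightarrow> real"
  assumes nonneg: "\<And>i j. f i j \<ge> 0"
    and rows: "\<And>i. f i sums g i" and total: "g sums S"
    and columns: "\<And>j. (\<lambda>i. f i j) sums h j"
  shows "h sums S"
proof -
  have "0 \<le> g i" for i
    using sums_le[of "\<lambda>_. 0" "f i" 0 "g i"] nonneg rows by simp
  hence g: "(g has_sum S) UNIV"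
    using total by (intro sums_nonneg_imp_has_sum) auto
  have f: "(f i has_sum g i) UNIV" for i
    using rows nonneg by (intro sums_nonneg_imp_has_sum) auto
  have "(\<lambda>p. norm (case p of (i, j) \<Rightarrow> f i j)) summable_on UNIV \<times> UNIV"
    using has_sum_imp_summable[OF f] has_sum_imp_summable[OF g] nonneg \<open>\<And>i. 0 \<le> g i\<close>
    by (subst Infinite_Sum.abs_summable_on_Sigma_iff) (simp add: infsumI[OF f])
  hence summable: "(\<lambda>(i, j). f i j) summable_on UNIV \<times> UNIV"
    by (rule abs_summable_summable)
  have "((\<lambda>(i, j). f i j) has_sum S) (UNIV \<times> UNIV)"
    by (rule has_sum_SigmaI[where g = g]) (simp_all only: prod.case f g summable)
  hence "((\<lambda>(j, i). f i j) has_sum S) (UNIV \<times> UNIV)"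
    by (subst has_sum_swap) (simp only: prod.case)
  moreover have "((\<lambda>i. f i j) has_sum h j) UNIV" for j
    using columns nonneg by (intro sums_nonneg_imp_has_sum) auto
  ultimately have "(h has_sum S) UNIV"
    by (elim has_sum_SigmaD) (simp only: prod.case)
  thus ?thesis by (rule has_sum_imp_sums)
qed

text \<open>
  The linear term of the logarithm series is removed because it is not summable over
  \<open>y = x / j\<close>; the remaining terms start at the exponent 2, where the zeta values begin.
\<close>

lemma ln_one_minus_tail_sums:
  fixes y :: real
  assumes "\<bar>y\<bar> < 1"
  shows "(\<lambda>k. y ^ (k + 2) / real (k + 2)) sums (- ln (1 - y) - y)"
proof -
  have "(\<lambda>n. - (- (y ^ n / real n))) sums - ln (1 - y)"
    using sums_minus[OF ln_series'[of "-y"]] assms by simp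
  hence "(\<lambda>n. y ^ n / real n) sums - ln (1 - y)" by simp
  from sums_split_initial_segment[OF this, of 2] show ?thesis
    by (simp add: numeral_2_eq_2)
qed

lemma zeta_sums:
  assumes "k \<ge> 2"
  shows "(\<lambda>j. 1 / real (Suc j) ^ k) sums zeta (real k)"
proof -
  have "summable (\<lambda>j. 1 / real (Suc j) ^ k)"
    using inverse_power_summable[of k, where ?'a = real] assms
    by (subst summable_Suc_iff[where f = "\<lambda>j. 1 / real j ^ k"])
       (simp add: inverse_eq_divide)
  thus ?thesis
    unfolding zeta_def by (simp add: powr_realpow sums_iff del: of_nat_Suc)
qed

text \<open>
  Weierstrass' product at \<open>- x\<close> reads
  \<open>- x * Gamma (- x) = exp (\<gamma> x) * (\<Prod>j\<ge>1. exp (- x / j) / (1 - x / j))\<close>, and the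
  left-hand side is \<open>Gamma (1 - x)\<close> by the functional equation. All factors are positive
  for \<open>0 < x < 1\<close>, so the real logarithm turns the product into a series.
\<close>

lemma ln_Gamma_one_minus_sums:
  fixes x :: real
  assumes "0 < x" "x < 1"
  shows "(\<lambda>j. - ln (1 - x / real (Suc j)) - x / real (Suc j))
           sums (ln (Gamma (1 - x)) - euler_mascheroni * x)"
proof -
  let ?a = "\<lambda>j. - ln (1 - x / real (Suc j)) - x / real (Suc j)"
  have small: "x / real (Suc j) < 1" for j
    using assms by (simp add: field_simps)
  have "- x \<notin> \<int>\<^sub>\<le>\<^sub>0"
  proof
    assume "- x \<in> \<int>\<^sub>\<le>\<^sub>0"
    then obtain i where "- x = of_int i" by (elim nonpos_Ints_cases)
    with assms have "- 1 < i" "i < 0" by linarith+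
    thus False by simp
  qed
  hence Gamma_eq: "Gamma (1 - x) = - x * Gamma (- x)"
    using Gamma_plus1[of "- x"] by simp
  have "(\<lambda>n. - x * Gamma_series_Weierstrass (- x) n) \<longlonglongrightarrow> Gamma (1 - x)"
    unfolding Gamma_eq by (intro tendsto_intros Gamma_Weierstrass_real)
  moreover have "- x * Gamma_series_Weierstrass (- x) n =
      exp (euler_mascheroni * x + (\<Sum>j<n. ?a j))" for n
  proof -
    have "exp (- ln (1 - y) - y) = exp (- y) / (1 + - y)" if "y < 1" for y :: real
      using that by (simp add: exp_diff exp_minus divide_inverse mult.commute)
    from this[OF small]
    have "exp (?a j) = exp (- x / real (Suc j)) / (1 + - x / real (Suc j))" for j
      by (simp del: of_nat_Suc)
    hence "exp (\<Sum>j<n. ?a j) =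
        (\<Prod>k=1..n. exp (- x / real k) / (1 + - x / real k))"
      by (simp add: exp_sum prod.atLeast1_atMost_eq del: of_nat_Suc)
    thus ?thesis
      using assms by (simp add: Gamma_series_Weierstrass_def exp_add)
  qed
  ultimately have lim: "(\<lambda>n. exp (euler_mascheroni * x + (\<Sum>j<n. ?a j))) \<longlonglongrightarrow> Gamma (1 - x)"
    by (simp only:)
  have "Gamma (1 - x) \<noteq> 0"
    using Gamma_real_pos[of "1 - x"] assms by linarith
  from tendsto_ln[OF lim this]
  have "(\<lambda>n. euler_mascheroni * x + (\<Sum>j<n. ?a j)) \<longlonglongrightarrow> ln (Gamma (1 - x))"
    by (simp only: ln_exp)
  from tendsto_diff[OF this tendsto_const[of "euler_mascheroni * x"]] show ?thesis
    unfolding sums_def by (simp only: add_diff_cancel_left')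
qed

text \<open>
  Expanding each logarithm of the preceding series in powers of \<open>x / j\<close> gives a double
  series with nonnegative terms; collecting equal powers of \<open>x\<close> first, the sum over \<open>j\<close>
  becomes a zeta value.
\<close>

lemma zeta_power_series:
  fixes x :: real
  assumes "0 < x" "x < 1"
  shows "(\<lambda>k. zeta (real (k + 2)) / real (k + 2) * x ^ (k + 2))
           sums (ln (Gamma (1 - x)) - euler_mascheroni * x)"
proof (rule sums_swap_nonneg)
  let ?f = "\<lambda>j k. (x / real (Suc j)) ^ (k + 2) / real (k + 2)"
  show "?f j k \<ge> 0" for j k using assms by simp
  show "?f j sums (- ln (1 - x / real (Suc j)) - x / real (Suc j))" for j
    using assms by (intro ln_one_minus_tail_sums) (simp add: field_simps)
  show "(\<lambda>j. - ln (1 - x / real (Suc j)) - x / real (Suc j))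
           sums (ln (Gamma (1 - x)) - euler_mascheroni * x)"
    by (rule ln_Gamma_one_minus_sums[OF assms])
  show "(\<lambda>j. ?f j k) sums (zeta (real (k + 2)) / real (k + 2) * x ^ (k + 2))" for k
  proof -
    have "?f j k = x ^ (k + 2) / real (k + 2) * (1 / real (Suc j) ^ (k + 2))" for j
      by (simp only: power_divide times_divide_times_eq divide_divide_eq_left mult_1_right
            mult.commute)
    moreover have "zeta (real (k + 2)) / real (k + 2) * x ^ (k + 2) =
        x ^ (k + 2) / real (k + 2) * zeta (real (k + 2))"
      by (simp only: times_divide_eq_left times_divide_eq_right mult.commute)
    ultimately show ?thesis
      using sums_mult[OF zeta_sums[of "k + 2"], of "x ^ (k + 2) / real (k + 2)"]
      by (simp only: le_add2)
  qed
qed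

lemma zeta_series_reciprocal:
  fixes N :: real
  assumes "N > 1"
  shows "(\<lambda>k. zeta (real (k + 2)) / (real (k + 2) * N ^ (k + 2)))
           sums (ln (Gamma ((N - 1) / N)) - euler_mascheroni / N)"
proof -
  have "zeta (real (k + 2)) / real (k + 2) * (1 / N) ^ (k + 2) =
      zeta (real (k + 2)) / (real (k + 2) * N ^ (k + 2))" for k
    by (simp only: power_divide power_one times_divide_times_eq mult_1_right)
  moreover have "1 - 1 / N = (N - 1) / N"
    using assms by (simp add: diff_divide_distrib)
  moreover have "0 < 1 / N" "1 / N < 1"
    using assms by simp_all
  ultimately show ?thesis
    using zeta_power_series[of "1 / N"] by (simp only: times_divide_eq_right mult_1_right)
qed

section \<open>Products of Fibonacci and Lucas numbers\<close>

definition golden :: real where "golden = (1 + sqrt 5) / 2"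
definition golden_conj :: real where "golden_conj = (1 - sqrt 5) / 2"

lemma golden_powers: "golden ^ n * golden_conj ^ n = (-1) ^ n"
proof -
  have "golden * golden_conj = -1"
    by (simp add: golden_def golden_conj_def field_simps)
  thus ?thesis by (metis power_mult_distrib)
qed

lemma fib_Binet: "real (fib n) = (golden ^ n - golden_conj ^ n) / sqrt 5"
  unfolding golden_def golden_conj_def by (rule fib_closed_form)

lemma lucas_Binet: "real (lucas n) = golden ^ n + golden_conj ^ n"
proof (induction n rule: lucas.induct)
  case (3 n)
  have sq: "golden * golden = golden + 1" "golden_conj * golden_conj = golden_conj + 1"
    by (simp_all add: golden_def golden_conj_def field_simps)
  have "golden ^ Suc (Suc n) = golden ^ Suc n + golden ^ n"
    "golden_conj ^ Suc (Suc n) = golden_conj ^ Suc n + golden_conj ^ n"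
    by (simp_all add: sq distrib_right flip: mult.assoc)
  with 3 show ?case by simp
qed (simp_all add: golden_def golden_conj_def field_simps)

text \<open>
  The Binet formulas turn this identity and the next four into polynomial identities in powers
  of \<open>golden\<close> and \<open>golden_conj\<close>. Differences \<open>n - m\<close> are resolved by \<open>n = m + k\<close>, and a sign
  is written back by \<open>golden_powers\<close> as a product of conjugate powers.
\<close>

lemma lucas_fib_add:
  "real (lucas n) * real (fib m) + real (fib n) * real (lucas m) = 2 * real (fib (n + m))"
  by (simp add: lucas_Binet fib_Binet power_add field_simps)

text \<open>
  Catalan's identity. The sign \<open>(-1) ^ (n + m - 1)\<close> equals \<open>- (-1) ^ (n - m)\<close>, so here the
  conjugate powers with exponent \<open>n - m\<close> represent it.
\<close>

lemma fib_Catalan: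
  assumes "m < n"
  shows "(real (fib n))\<^sup>2 + (-1) ^ (n + m - 1) * (real (fib m))\<^sup>2 =
         real (fib (n - m)) * real (fib (n + m))"
proof -
  obtain k where n: "n = m + k" and "k > 0"
    using assms by (metis less_imp_add_positive)
  have sign: "(-1 :: real) ^ (n + m - 1) = - (golden ^ k * golden_conj ^ k)"
    unfolding golden_powers n using \<open>k > 0\<close> by (cases k) (simp_all add: power_add)
  have "((a * c - b * d) / sqrt 5)\<^sup>2 - c * d * ((a - b) / sqrt 5)\<^sup>2 =
      (c - d) / sqrt 5 * ((a * c * a - b * d * b) / sqrt 5)" for a b c d :: real
    by (simp add: power_divide flip: diff_divide_distrib)
       (simp add: power2_eq_square algebra_simps)
  thus ?thesis unfolding sign
    by (simp add: n fib_Binet power_add)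
qed

lemma lucas_mult_lucas:
  assumes "m \<le> n"
  shows "real (lucas (n + m)) + (-1) ^ m * real (lucas (n - m)) =
         real (lucas m) * real (lucas n)"
proof -
  obtain k where n: "n = m + k" using assms by (metis le_iff_add)
  show ?thesis unfolding golden_powers[symmetric]
    by (simp add: n lucas_Binet power_add algebra_simps)
qed

lemma five_fib_mult_fib:
  assumes "1 \<le> m" "m \<le> n"
  shows "real (lucas (n + m)) + (-1) ^ (m - 1) * real (lucas (n - m)) =
         5 * real (fib m) * real (fib n)"
proof -
  obtain k where n: "n = m + k" using assms by (metis le_iff_add)
  have sign: "(-1 :: real) ^ (m - 1) = - (golden ^ m * golden_conj ^ m)"
    using assms by (cases m) (simp_all add: golden_powers del: power_Suc, simp)
  show ?thesis unfolding sign
    by (simp add: n lucas_Binet fib_Binet power_add field_simps)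
qed

lemma fib_mult_lucas:
  assumes "1 \<le> m" "m \<le> n"
  shows "real (fib (n + m)) + (-1) ^ (m - 1) * real (fib (n - m)) =
         real (fib m) * real (lucas n)"
proof -
  obtain k where n: "n = m + k" using assms by (metis le_iff_add)
  have sign: "(-1 :: real) ^ (m - 1) = - (golden ^ m * golden_conj ^ m)"
    using assms by (cases m) (simp_all add: golden_powers del: power_Suc, simp)
  show ?thesis unfolding sign
    by (simp add: n lucas_Binet fib_Binet power_add field_simps)
qed


section \<open>Evaluation at Fibonacci and Lucas products\<close>

lemma lucas_pos: "lucas n > 0"
  by (induction n rule: lucas.induct) simp_all

lemma two_le_lucas:
  assumes "n \<ge> 2"
  shows "lucas n \<ge> 2"
proof -
  obtain k where "n = Suc (Suc k)"
    using assms by (metis add_2_eq_Suc le_iff_add)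
  thus ?thesis
    using lucas_pos[of "Suc k"] lucas_pos[of k] by simp
qed

lemma two_le_fib:
  assumes "n \<ge> 3"
  shows "fib n \<ge> 2"
  using fib_mono[OF assms] by (simp add: numeral_3_eq_3)

text \<open>
  In each part the conditions on \<open>m\<close> and \<open>n\<close> force the denominator to be an integer \<open>N \<ge> 2\<close>,
  as \<open>zeta_series_reciprocal\<close> demands. At \<open>m = n = 1\<close> the third and the fifth part would have
  \<open>N = 1\<close>, where the zeta series diverges.
\<close>

theorem theorem3p2p1:
  fixes m n :: nat
  assumes "m \<ge> 1" and "n \<ge> m"
  shows
    "((\<lambda>k. zeta (real (k + 2)) /
          (real (k + 2) *
            (real (lucas n) * real (fib m) + real (fib n) * real (lucas m)) ^ (k + 2)))
      sums (ln (Gamma ((2 * real (fib (n + m)) - 1) / (2 * real (fib (n + m)))))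
            - euler_mascheroni / (2 * real (fib (n + m))))) \<and>
     (n > m \<longrightarrow>
     (\<lambda>k. zeta (real (k + 2)) /
          (real (k + 2) *
            ((real (fib n))\<^sup>2 + (-1) ^ (n + m - 1) * (real (fib m))\<^sup>2) ^ (k + 2)))
      sums (ln (Gamma ((real (fib (n - m)) * real (fib (n + m)) - 1) /
                       (real (fib (n - m)) * real (fib (n + m)))))
            - euler_mascheroni / (real (fib (n - m)) * real (fib (n + m))))) \<and>
     ((m, n) \<noteq> (1, 1) \<longrightarrow>
     (\<lambda>k. zeta (real (k + 2)) /
          (real (k + 2) *
            (real (lucas (n + m)) + (-1) ^ m * real (lucas (n - m))) ^ (k + 2)))
      sums (ln (Gamma ((real (lucas m) * real (lucas n) - 1) /
                       (real (lucas m) * real (lucas n))))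
            - euler_mascheroni / (real (lucas m) * real (lucas n)))) \<and>
     ((\<lambda>k. zeta (real (k + 2)) /
          (real (k + 2) * (5 * real (fib m) * real (fib n)) ^ (k + 2)))
      sums (ln (Gamma ((real (lucas (n + m)) + (-1) ^ (m - 1) * real (lucas (n - m)) - 1) /
                       (real (lucas (n + m)) + (-1) ^ (m - 1) * real (lucas (n - m)))))
            - euler_mascheroni /
              (real (lucas (n + m)) + (-1) ^ (m - 1) * real (lucas (n - m))))) \<and>
     ((m, n) \<noteq> (1, 1) \<longrightarrow>
     (\<lambda>k. zeta (real (k + 2)) /
          (real (k + 2) * (real (fib m) * real (lucas n)) ^ (k + 2)))
      sums (ln (Gamma ((real (fib (n + m)) + (-1) ^ (m - 1) * real (fib (n - m)) - 1) /
                       (real (fib (n + m)) + (-1) ^ (m - 1) * real (fib (n - m)))))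
            - euler_mascheroni /
              (real (fib (n + m)) + (-1) ^ (m - 1) * real (fib (n - m)))))"
proof (intro conjI impI)
  have fib_m: "real (fib m) \<ge> 1" and fib_n: "real (fib n) \<ge> 1"
    and fib_sum: "real (fib (n + m)) \<ge> 1"
    using fib_neq_0_nat[of m] fib_neq_0_nat[of n] fib_neq_0_nat[of "n + m"] assms by linarith+
  have product: "x * y > 1" if "x \<ge> 1" "y \<ge> 2" for x y :: real
    using mult_mono[of 1 x 2 y] that by simp
  have lucas_m: "real (lucas m) \<ge> 1"
    using lucas_pos[of m] by linarith
  have lucas_n: "real (lucas n) \<ge> 2" if "(m, n) \<noteq> (1, 1)"
    using two_le_lucas[of n] that assms by (cases "n = 1") auto

  show "(\<lambda>k. zeta (real (k + 2)) /
      (real (k + 2) *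
      (real (lucas n) * real (fib m) + real (fib n) * real (lucas m)) ^ (k + 2)))
      sums (ln (Gamma ((2 * real (fib (n + m)) - 1) / (2 * real (fib (n + m)))))
      - euler_mascheroni / (2 * real (fib (n + m))))"
    unfolding lucas_fib_add
    by (rule zeta_series_reciprocal) (use fib_sum in linarith)

  show "(\<lambda>k. zeta (real (k + 2)) /
      (real (k + 2) *
      ((real (fib n))\<^sup>2 + (-1) ^ (n + m - 1) * (real (fib m))\<^sup>2) ^ (k + 2)))
      sums (ln (Gamma ((real (fib (n - m)) * real (fib (n + m)) - 1) /
      (real (fib (n - m)) * real (fib (n + m)))))
      - euler_mascheroni / (real (fib (n - m)) * real (fib (n + m))))" if "n > m"
  proof -
    have "real (fib (n - m)) \<ge> 1"
      using fib_neq_0_nat[of "n - m"] that by linarith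
    moreover have "real (fib (n + m)) \<ge> 2"
      using two_le_fib[of "n + m"] that assms by linarith
    ultimately show ?thesis
      unfolding fib_Catalan[OF that] by (intro zeta_series_reciprocal product)
  qed

  show "(\<lambda>k. zeta (real (k + 2)) /
      (real (k + 2) *
      (real (lucas (n + m)) + (-1) ^ m * real (lucas (n - m))) ^ (k + 2)))
      sums (ln (Gamma ((real (lucas m) * real (lucas n) - 1) /
      (real (lucas m) * real (lucas n))))
      - euler_mascheroni / (real (lucas m) * real (lucas n)))" if "(m, n) \<noteq> (1, 1)"
    unfolding lucas_mult_lucas[OF assms(2)]
    by (intro zeta_series_reciprocal product lucas_m lucas_n that)

  have "5 * real (fib m) * real (fib n) > 1"
    using product[OF fib_n, of "5 * real (fib m)"] fib_m by (simp add: mult.commute)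
  show "(\<lambda>k. zeta (real (k + 2)) /
      (real (k + 2) * (5 * real (fib m) * real (fib n)) ^ (k + 2)))
      sums (ln (Gamma ((real (lucas (n + m)) + (-1) ^ (m - 1) * real (lucas (n - m)) - 1) /
      (real (lucas (n + m)) + (-1) ^ (m - 1) * real (lucas (n - m)))))
      - euler_mascheroni /
      (real (lucas (n + m)) + (-1) ^ (m - 1) * real (lucas (n - m))))"
    unfolding five_fib_mult_fib[OF assms]
    by (rule zeta_series_reciprocal) fact

  show "(\<lambda>k. zeta (real (k + 2)) /
      (real (k + 2) * (real (fib m) * real (lucas n)) ^ (k + 2)))
      sums (ln (Gamma ((real (fib (n + m)) + (-1) ^ (m - 1) * real (fib (n - m)) - 1) /
      (real (fib (n + m)) + (-1) ^ (m - 1) * real (fib (n - m)))))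
      - euler_mascheroni /
      (real (fib (n + m)) + (-1) ^ (m - 1) * real (fib (n - m))))" if "(m, n) \<noteq> (1, 1)"
    unfolding fib_mult_lucas[OF assms]
    by (intro zeta_series_reciprocal product fib_m lucas_n that)
qed

end
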